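(* Let $q_1,q_2\in\mathbb{R}^2$ be distinct and let $L_{\mathcal{Q}}=\operatorname{Aff}\{q_1,q_2\}$ be the line through them. Let $U\subseteq\mathbb{R}^2\setminus\{q_1,q_2\}$ be any common angle-chart domain, with smooth angle lifts $\varphi_1,\varphi_2:U\to\mathbb{R}$ and $\mathsf{H}_{\mathcal{Q}}=(\varphi_1,\varphi_2):U\to\mathbb{R}^2$. Then the critical set satisfies $$\{x\in U:\operatorname{rank}D_x\mathsf{H}_{\mathcal{Q}}(x)\le 1\}=L_{\mathcal{Q}}\cap U.$$ Thus the pair of radial angle maps satisfies the critical-hypersurface condition locally (on $U$). At every $x\in L_{\mathcal{Q}}\cap U$, however, $$\operatorname{rank}\big(D_x\mathsf{H}_{\mathcal{Q}}(x)|_{T_xL_{\mathcal{Q}}}\big)=0.$$ Consequently, the tangential-immersion condition fails along the critical line $L_{\mathcal{Q}}\cap U$. The encoding $\mathsf{H}_{\mathcal{Q}}$ is also not fold non-degenerate at the points of $L_{\mathcal{Q}}\cap U$.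
   Context: The radial projection based at $q_j$ is $\pi_{q_j}(x)=\frac{x-q_j}{|x-q_j|}$ for $x\in\mathbb{R}^2\setminus\{q_j\}$. A common angle-chart domain is an open set $U\subseteq\mathbb{R}^2\setminus\{q_1,q_2\}$ on which there are smooth functions (angle lifts) $\varphi_1,\varphi_2:U\to\mathbb{R}$ with $\pi_{q_j}(x)=(\cos\varphi_j(x),\sin\varphi_j(x))$ for all $x\in U$, $j=1,2$. In this planar setting, with $\Sigma=\{x\in U:\operatorname{rank}D_x\mathsf{H}_{\mathcal{Q}}(x)\le1\}$: the critical-hypersurface condition on $U$ is that $\Sigma$ is contained in a $C^1$ embedded one-dimensional submanifold $M\subseteq U$ (possibly empty); the tangential-immersion condition relative to $M$ is that $\operatorname{rank}(D_x\mathsf{H}_{\mathcal{Q}}(x)|_{T_xM})=1$ for every $x\in M$. With $J=\det D_x\mathsf{H}_{\mathcal{Q}}$, the map $\mathsf{H}_{\mathcal{Q}}$ is fold non-degenerate at $x\in\Sigma$ if $\operatorname{rank}D_x\mathsf{H}_{\mathcal{Q}}(x)=1$ and $D_xJ(x)[v]\neq0$ for all $v\in\ker D_x\mathsf{H}_{\mathcal{Q}}(x)\setminus\{0\}$. *)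

theory Defs
  imports "HOL-Analysis.Analysis"
begin

text \<open>\<open>C\<close>-\<open>k\<close> maps on an open set. In finite dimension, continuity of \<open>x \<mapsto> D f(x)\<close> is continuity of
  \<open>x \<mapsto> D f(x)[v]\<close> for each fixed \<open>v\<close>, which is what the recursion uses.\<close>

primrec C_k_on :: "nat \<Rightarrow> 'a::euclidean_space set \<Rightarrow> ('a \<Rightarrow> 'b::real_normed_vector) \<Rightarrow> bool" where
  "C_k_on 0 U f \<longleftrightarrow> continuous_on U f"
| "C_k_on (Suc k) U f \<longleftrightarrow>
     (\<forall>x\<in>U. f differentiable (at x)) \<and> (\<forall>v. C_k_on k U (\<lambda>x. frechet_derivative f (at x) v))"

definition smooth_on :: "'a::euclidean_space set \<Rightarrow> ('a \<Rightarrow> 'b::real_normed_vector) \<Rightarrow> bool" where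
  "smooth_on U f \<longleftrightarrow> (\<forall>k. C_k_on k U f)"

definition C1_diffeo :: "'a::euclidean_space set \<Rightarrow> 'a set \<Rightarrow> ('a \<Rightarrow> 'a) \<Rightarrow> ('a \<Rightarrow> 'a) \<Rightarrow> bool" where
  "C1_diffeo V W f g \<longleftrightarrow>
     open V \<and> open W \<and> homeomorphism V W f g \<and> C_k_on 1 V f \<and> C_k_on 1 W g"

text \<open>Embedded submanifolds via slice charts; \<open>M\<close> may be empty and need not be closed.\<close>

definition C1_submanifold :: "nat \<Rightarrow> 'a::euclidean_space set \<Rightarrow> bool" where
  "C1_submanifold d M \<longleftrightarrow>
     (\<forall>x\<in>M. \<exists>V W f g S. x \<in> V \<and> C1_diffeo V W f g \<and> subspace S \<and> dim S = d \<and>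
        f ` (M \<inter> V) = W \<inter> S)"

text \<open>Velocities at \<open>x\<close> of \<open>C\<close>-\<open>1\<close> curves in \<open>M\<close>.\<close>

definition tangent_space :: "'a::euclidean_space set \<Rightarrow> 'a \<Rightarrow> 'a set" where
  "tangent_space M x =
     {v. \<exists>\<gamma> e. e > (0::real) \<and> C_k_on 1 {-e<..<e} \<gamma> \<and> \<gamma> ` {-e<..<e} \<subseteq> M \<and>
           \<gamma> 0 = x \<and> (\<gamma> has_vector_derivative v) (at 0)}"

definition radial_projection :: "real^2 \<Rightarrow> real^2 \<Rightarrow> real^2" where
  "radial_projection q x = (x - q) /\<^sub>R norm (x - q)"

definition angle_lift :: "real^2 \<Rightarrow> (real^2) set \<Rightarrow> (real^2 \<Rightarrow> real) \<Rightarrow> bool" where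
  "angle_lift q U \<phi> \<longleftrightarrow>
     smooth_on U \<phi> \<and> (\<forall>x\<in>U. radial_projection q x = vector [cos (\<phi> x), sin (\<phi> x)])"

definition critical_set :: "(real^2) set \<Rightarrow> (real^2 \<Rightarrow> real^2) \<Rightarrow> (real^2) set" where
  "critical_set U H = {x \<in> U. rank (matrix (frechet_derivative H (at x))) \<le> 1}"

definition critical_hypersurface ::
  "(real^2) set \<Rightarrow> (real^2 \<Rightarrow> real^2) \<Rightarrow> (real^2) set \<Rightarrow> bool" where
  "critical_hypersurface U H M \<longleftrightarrow> M \<subseteq> U \<and> C1_submanifold 1 M \<and> critical_set U H \<subseteq> M"

definition critical_hypersurface_condition :: "(real^2) set \<Rightarrow> (real^2 \<Rightarrow> real^2) \<Rightarrow> bool" where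
  "critical_hypersurface_condition U H \<longleftrightarrow> (\<exists>M. critical_hypersurface U H M)"

definition tangential_rank :: "(real^2 \<Rightarrow> real^2) \<Rightarrow> (real^2) set \<Rightarrow> real^2 \<Rightarrow> nat" where
  "tangential_rank H M x = dim (frechet_derivative H (at x) ` tangent_space M x)"

definition tangential_immersion_condition :: "(real^2 \<Rightarrow> real^2) \<Rightarrow> (real^2) set \<Rightarrow> bool" where
  "tangential_immersion_condition H M \<longleftrightarrow> (\<forall>x\<in>M. tangential_rank H M x = 1)"

definition jacobian_det :: "(real^2 \<Rightarrow> real^2) \<Rightarrow> real^2 \<Rightarrow> real" where
  "jacobian_det H x = det (matrix (frechet_derivative H (at x)))"

definition fold_nondegenerate_at :: "(real^2 \<Rightarrow> real^2) \<Rightarrow> real^2 \<Rightarrow> bool" where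
  "fold_nondegenerate_at H x \<longleftrightarrow>
     rank (matrix (frechet_derivative H (at x))) = 1 \<and>
     (\<forall>v. frechet_derivative H (at x) v = 0 \<and> v \<noteq> 0 \<longrightarrow>
        frechet_derivative (jacobian_det H) (at x) v \<noteq> 0)"

end

theory Submission
  imports Defs
begin

text \<open>Writing \<open>w \<times> v\<close> for the planar cross product, differentiating
  \<open>(x - q) \<times> (cos \<phi>, sin \<phi>) = 0\<close> gives \<open>D\<phi>(x)[v] = ((x - q) \<times> v) / |x - q|\<^sup>2\<close>.
  Hence the Jacobian determinant of the pair of angles is
  \<open>((x - q\<^sub>1) \<times> (x - q\<^sub>2)) / (|x - q\<^sub>1|\<^sup>2 |x - q\<^sub>2|\<^sup>2)\<close>, which vanishes exactly on the line through
  \<open>q\<^sub>1\<close> and \<open>q\<^sub>2\<close>; there the direction \<open>q\<^sub>2 - q\<^sub>1\<close> lies in the kernel of the differential. Any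
  one-dimensional submanifold containing the critical set therefore has its tangent line inside the
  kernel, and the Jacobian, being constant along the critical line, has zero derivative in the
  kernel direction.\<close>

section \<open>Planar cross product and the line through two points\<close>

definition cross2 :: "real^2 \<Rightarrow> real^2 \<Rightarrow> real" where
  "cross2 w v = w$1 * v$2 - w$2 * v$1"

lemma bounded_bilinear_cross2: "bounded_bilinear cross2"
proof -
  interpret f: bounded_bilinear "\<lambda>w v :: real^2. w$1 * v$2"
    by (rule bounded_bilinear.comp[OF bounded_bilinear_mult bounded_linear_vec_nth bounded_linear_vec_nth])
  interpret g: bounded_bilinear "\<lambda>w v :: real^2. w$2 * v$1"
    by (rule bounded_bilinear.comp[OF bounded_bilinear_mult bounded_linear_vec_nth bounded_linear_vec_nth])
  have "bounded_linear (\<lambda>w. cross2 w v)" for v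
    unfolding cross2_def by (intro bounded_linear_sub f.bounded_linear_left g.bounded_linear_left)
  moreover have "bounded_linear (cross2 w)" for w
    unfolding cross2_def by (intro bounded_linear_sub f.bounded_linear_right g.bounded_linear_right)
  ultimately show ?thesis
    unfolding bilinear_conv_bounded_bilinear[symmetric] bilinear_def
    by (auto intro: bounded_linear.linear)
qed

interpretation cross2: bounded_bilinear cross2
  by (rule bounded_bilinear_cross2)

lemma cross2_self [simp]: "cross2 w w = 0"
  by (simp add: cross2_def)

lemma norm_vec2_power2: "(norm (w :: real^2))\<^sup>2 = (w$1)\<^sup>2 + (w$2)\<^sup>2"
  unfolding power2_norm_eq_inner by (simp add: inner_vec_def sum_2 power2_eq_square)

lemma cross2_eq_0_iff:
  assumes "w \<noteq> 0"
  shows "cross2 w v = 0 \<longleftrightarrow> (\<exists>c. v = c *\<^sub>R w)"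
proof
  assume cr: "cross2 w v = 0"
  have n: "(w$1)\<^sup>2 + (w$2)\<^sup>2 \<noteq> 0"
    using assms norm_vec2_power2[of w] by (metis norm_eq_zero power_eq_0_iff)
  \<comment> \<open>The coefficient of the orthogonal projection of \<open>v\<close> onto
    \<open>w\<close>. In each identity below, the two sides differ by a multiple of
    \<open>cross2 w v\<close>.\<close>
  define c where "c = (w \<bullet> v) / ((w$1)\<^sup>2 + (w$2)\<^sup>2)"
  have "v$1 * ((w$1)\<^sup>2 + (w$2)\<^sup>2) = (w \<bullet> v) * w$1" "v$2 * ((w$1)\<^sup>2 + (w$2)\<^sup>2) = (w \<bullet> v) * w$2"
    using cr unfolding cross2_def inner_vec_def sum_2 inner_real_def by algebra+
  then have "v$1 = c * w$1" "v$2 = c * w$2"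
    using n by (simp_all add: c_def field_simps)
  then have "v = c *\<^sub>R w"
    by (simp add: vec_eq_iff forall_2)
  then show "\<exists>c. v = c *\<^sub>R w" ..
qed (auto simp: cross2_def)

text \<open>Turns membership in the line into the vanishing of an affine function, which can be
  differentiated along curves and compared with the Jacobian.\<close>

lemma affine_hull_2_cross2:
  assumes "q1 \<noteq> q2"
  shows "x \<in> affine hull {q1, q2} \<longleftrightarrow> cross2 (q2 - q1) (x - q1) = 0"
proof -
  have "x \<in> affine hull {q1, q2} \<longleftrightarrow> (\<exists>c. x = q1 + c *\<^sub>R (q2 - q1))"
    unfolding affine_hull_2_alt by auto
  also have "\<dots> \<longleftrightarrow> (\<exists>c. x - q1 = c *\<^sub>R (q2 - q1))"
    by (simp add: algebra_simps)
  finally show ?thesis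
    using assms by (simp add: cross2_eq_0_iff)
qed

section \<open>Submanifolds and tangent vectors\<close>

lemma C_k_on_1_differentiable:
  assumes "C_k_on 1 U f" "x \<in> U"
  shows "f differentiable (at x)"
  using assms by simp

lemma C_k_on_1_translation:
  "C_k_on 1 U (\<lambda>x. x + a :: 'a::euclidean_space)"
proof -
  have D: "((\<lambda>x. x + a) has_derivative (\<lambda>v. v)) (at x)" for x :: 'a
    by (auto intro!: derivative_eq_intros)
  have "frechet_derivative (\<lambda>x. x + a) (at x) = (\<lambda>v. v)" for x :: 'a
    by (rule frechet_derivative_at[symmetric, OF D])
  then show ?thesis
    using D by (auto simp: differentiable_def)
qed

text \<open>Translation by \<open>- q\<close> carries the line onto \<open>span {d}\<close>, so this
  one map, restricted to \<open>U\<close>, is a slice chart at every point.\<close>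

lemma C1_submanifold_affine_line:
  fixes q d :: "'a::euclidean_space"
  assumes "open U" "d \<noteq> 0"
  shows "C1_submanifold 1 ({q + c *\<^sub>R d | c. True} \<inter> U)"
  unfolding C1_submanifold_def
proof (intro ballI exI conjI)
  let ?f = "\<lambda>x. x + (- q)" and ?g = "\<lambda>x. x + q"
  fix x assume "x \<in> {q + c *\<^sub>R d | c. True} \<inter> U"
  then show "x \<in> U" by simp
  have "homeomorphism U (?f ` U) ?f ?g"
    by (auto simp: homeomorphism_def intro!: continuous_intros image_eqI)
  moreover have "open (?f ` U)"
    using open_translation[OF \<open>open U\<close>, of "- q"] by (simp add: add.commute)
  ultimately show "C1_diffeo U (?f ` U) ?f ?g"
    unfolding C1_diffeo_def using \<open>open U\<close> C_k_on_1_translation by blast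
  show "subspace (span {d})" by simp
  show "dim (span {d}) = 1"
    using \<open>d \<noteq> 0\<close> by (simp add: dim_insert)
  show "?f ` ({q + c *\<^sub>R d | c. True} \<inter> U \<inter> U) = ?f ` U \<inter> span {d}"
  proof -
    have "y \<in> {q + c *\<^sub>R d | c. True} \<longleftrightarrow> ?f y \<in> span {d}" for y
      by (auto simp: span_singleton algebra_simps)
    then show ?thesis by blast
  qed
qed

text \<open>Each functional given by a vector orthogonal to \<open>S\<close> is zero along the curve
  near \<open>t\<close>, hence kills \<open>v\<close>; and \<open>S\<close> is its own double
  orthogonal complement.\<close>

lemma has_vector_derivative_in_subspace:
  fixes f :: "real \<Rightarrow> 'a::euclidean_space"
  assumes "subspace S" and f: "(f has_vector_derivative v) (at t)"
    and ev: "\<forall>\<^sub>F s in nhds t. f s \<in> S"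
  shows "v \<in> S"
proof -
  have "u \<bullet> v = 0" if u: "u \<in> S\<^sup>\<bottom>" for u
  proof -
    have "((\<lambda>s. u \<bullet> f s) has_vector_derivative u \<bullet> v) (at t)"
      using f by (rule bounded_linear.has_vector_derivative[OF bounded_linear_inner_right])
    moreover have "\<forall>\<^sub>F s in nhds t. u \<bullet> f s = 0"
      using ev by eventually_elim (use u in \<open>auto simp: orthogonal_comp_def orthogonal_def inner_commute\<close>)
    then have "((\<lambda>s. u \<bullet> f s) has_vector_derivative 0) (at t)"
      using eventually_nhds_x_imp_x by (subst has_vector_derivative_cong_ev[where g = "\<lambda>_. 0"]) auto
    ultimately show ?thesis
      by (rule vector_derivative_unique_at)
  qed
  then have "v \<in> S\<^sup>\<bottom>\<^sup>\<bottom>"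
    by (auto simp: orthogonal_comp_def orthogonal_def)
  then show ?thesis
    by (simp add: orthogonal_comp_self \<open>subspace S\<close>)
qed

text \<open>Replaces the interval of the curve by an eventuality in \<open>nhds 0\<close>, the form
  that \<open>has_vector_derivative_in_subspace\<close> takes.\<close>

lemma tangent_spaceE:
  assumes "v \<in> tangent_space M x"
  obtains \<gamma> where "(\<gamma> has_vector_derivative v) (at 0)" "\<gamma> 0 = x" "\<forall>\<^sub>F t in nhds 0. \<gamma> t \<in> M"
proof -
  obtain \<gamma> e where *: "e > (0::real)" "\<gamma> ` {-e<..<e} \<subseteq> M" "\<gamma> 0 = x"
      "(\<gamma> has_vector_derivative v) (at 0)"
    using assms unfolding tangent_space_def by blast
  have "\<forall>\<^sub>F t in nhds 0. t \<in> {-e<..<e}"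
    using \<open>e > 0\<close> by (intro eventually_nhds_in_open) auto
  then have "\<forall>\<^sub>F t in nhds 0. \<gamma> t \<in> M"
    by (rule eventually_mono) (use * in blast)
  with * show thesis by (intro that)
qed

text \<open>The straight curve through \<open>x\<close> with velocity \<open>d\<close> stays in the
  open set \<open>U\<close> for small times, hence in \<open>M\<close>.\<close>

lemma line_direction_in_tangent_space:
  assumes "open U" "x \<in> U" and M: "\<And>c. x + c *\<^sub>R d \<in> U \<Longrightarrow> x + c *\<^sub>R d \<in> M"
  shows "d \<in> tangent_space M x"
proof -
  let ?\<gamma> = "\<lambda>t::real. x + t *\<^sub>R d"
  have "\<forall>\<^sub>F t in nhds 0. ?\<gamma> t \<in> U"
  proof -
    have "open (?\<gamma> -` U)"
      by (intro open_vimage \<open>open U\<close> continuous_intros)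
    then have "\<forall>\<^sub>F t in nhds 0. t \<in> ?\<gamma> -` U"
      using \<open>x \<in> U\<close> by (intro eventually_nhds_in_open) auto
    then show ?thesis by simp
  qed
  then obtain e where e: "e > 0" "\<And>t. dist t 0 < e \<Longrightarrow> ?\<gamma> t \<in> U"
    unfolding eventually_nhds_metric by blast
  have D: "(?\<gamma> has_derivative (\<lambda>h. h *\<^sub>R d)) (at t)" for t
    by (auto intro!: derivative_eq_intros)
  have FD: "frechet_derivative ?\<gamma> (at t) = (\<lambda>h. h *\<^sub>R d)" for t
    by (rule frechet_derivative_at[symmetric, OF D])
  have "C_k_on 1 {-e<..<e} ?\<gamma>"
    using D FD by (auto simp: differentiable_def)
  moreover have "?\<gamma> ` {-e<..<e} \<subseteq> M"
    using M e by auto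
  moreover have "(?\<gamma> has_vector_derivative d) (at 0)"
    using D by (simp add: has_vector_derivative_def)
  ultimately show ?thesis
    unfolding tangent_space_def using e(1)
    by (intro CollectI exI[of _ ?\<gamma>] exI[of _ e] conjI) (assumption | simp)+
qed

text \<open>The derivative of a slice chart is injective and sends all velocities into the
  one-dimensional \<open>S\<close>, so any nonzero velocity spans the others.\<close>

lemma tangent_space_subset_line:
  assumes M: "C1_submanifold 1 M" and x: "x \<in> M"
    and d: "d \<in> tangent_space M x" "d \<noteq> 0" and v: "v \<in> tangent_space M x"
  shows "\<exists>c. v = c *\<^sub>R d"
proof -
  obtain V W f g S where V: "x \<in> V" and diffeo: "C1_diffeo V W f g" and S: "subspace S" "dim S = 1"
    and image: "f ` (M \<inter> V) = W \<inter> S"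
    using M[unfolded C1_submanifold_def, rule_format, OF x] by (elim exE conjE) (rule that)
  have op: "open V" "open W" and hom: "homeomorphism V W f g"
    and Ck: "C_k_on 1 V f" "C_k_on 1 W g"
    using diffeo by (auto simp: C1_diffeo_def)
  have fx: "f x \<in> W" and gf: "\<And>y. y \<in> V \<Longrightarrow> g (f y) = y"
    using hom V by (auto simp: homeomorphism_def)
  obtain f' where f': "(f has_derivative f') (at x)"
    using C_k_on_1_differentiable[OF Ck(1) V] by (auto simp: differentiable_def)
  obtain g' where g': "(g has_derivative g') (at (f x))"
    using C_k_on_1_differentiable[OF Ck(2) fx] by (auto simp: differentiable_def)
  \<comment> \<open>Comparing the chain rule with \<open>g \<circ> f = id\<close> near
    \<open>x\<close> shows that \<open>g'\<close> is a left inverse of \<open>f'\<close>.\<close>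
  have "((g \<circ> f) has_derivative (g' \<circ> f')) (at x)"
    using f' g' by (rule diff_chain_at)
  moreover have "((g \<circ> f) has_derivative id) (at x)"
    by (rule has_derivative_transform_within_open[OF has_derivative_id op(1) V]) (simp add: gf)
  ultimately have "g' \<circ> f' = id"
    by (rule has_derivative_unique)
  then have inv: "g' (f' u) = u" for u
    by (simp add: fun_eq_iff)
  have lin: "linear f'" "linear g'"
    using f' g' by (auto dest: has_derivative_linear)
  have in_S: "f' u \<in> S" if "u \<in> tangent_space M x" for u
  proof -
    obtain \<gamma> where \<gamma>: "(\<gamma> has_vector_derivative u) (at 0)" "\<gamma> 0 = x" "\<forall>\<^sub>F t in nhds 0. \<gamma> t \<in> M"
      using \<open>u \<in> tangent_space M x\<close> by (rule tangent_spaceE)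
    have D: "((f \<circ> \<gamma>) has_vector_derivative f' u) (at 0)"
      using \<gamma>(1,2) f' by (intro vector_derivative_diff_chain_within) (auto intro: has_derivative_at_withinI)
    \<comment> \<open>By continuity the curve stays in the chart domain \<open>V\<close> near time
      0, where \<open>f\<close> flattens \<open>M\<close> into \<open>S\<close>.\<close>
    have "filterlim \<gamma> (nhds x) (nhds 0)"
      using has_vector_derivative_continuous[OF \<gamma>(1)] \<gamma>(2)
      by (simp add: isCont_def tendsto_nhds_iff)
    then have "\<forall>\<^sub>F t in nhds 0. \<gamma> t \<in> V"
      using op(1) V by (rule topological_tendstoD)
    with \<gamma>(3) have "\<forall>\<^sub>F t in nhds 0. (f \<circ> \<gamma>) t \<in> S"
      by eventually_elim (use image in auto)
    with S(1) D show ?thesis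
      by (rule has_vector_derivative_in_subspace)
  qed
  have "f' d \<noteq> 0"
    using inv[of d] d(2) linear_0[OF lin(2)] by auto
  have "S \<subseteq> span {f' d}"
    by (rule card_ge_dim_independent) (use S in_S[OF d(1)] \<open>f' d \<noteq> 0\<close> in auto)
  then obtain c where "f' v = c *\<^sub>R f' d"
    using in_S[OF v] by (auto simp: span_singleton)
  then have "v = c *\<^sub>R d"
    using inv[of v] inv[of d] linear_scale[OF lin(2)] by simp
  then show ?thesis ..
qed

text \<open>The affine function that cuts out the line vanishes along the curve, so its linear part
  kills the velocity.\<close>

lemma tangent_space_affine_hull_2:
  assumes "q1 \<noteq> q2" "v \<in> tangent_space (affine hull {q1, q2}) x"
  shows "cross2 (q2 - q1) v = 0"
proof -
  obtain \<gamma> where \<gamma>: "(\<gamma> has_vector_derivative v) (at 0)"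
      "\<forall>\<^sub>F t in nhds 0. \<gamma> t \<in> affine hull {q1, q2}"
    using assms(2) by (rule tangent_spaceE)
  have "((\<lambda>t. cross2 (q2 - q1) (\<gamma> t - q1)) has_vector_derivative cross2 (q2 - q1) (v - 0)) (at 0)"
    using \<gamma>(1) by (intro bounded_linear.has_vector_derivative[OF cross2.bounded_linear_right]
      has_vector_derivative_diff has_vector_derivative_const)
  moreover have "\<forall>\<^sub>F t in nhds 0. cross2 (q2 - q1) (\<gamma> t - q1) \<in> {0}"
    using \<gamma>(2) by (simp add: affine_hull_2_cross2[OF \<open>q1 \<noteq> q2\<close>])
  ultimately show ?thesis
    using has_vector_derivative_in_subspace[OF subspace_single_0] by fastforce
qed

section \<open>Derivatives of the angles and their Jacobian\<close>

lemma has_derivative_angle_lift: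
  assumes "angle_lift q U \<phi>" "open U" "x \<in> U" "x \<noteq> q"
  shows "(\<phi> has_derivative (\<lambda>v. cross2 (x - q) v / (norm (x - q))\<^sup>2)) (at x)"
proof -
  have polar: "y - q = norm (y - q) *\<^sub>R vector [cos (\<phi> y), sin (\<phi> y)]" if "y \<in> U" for y
  \<comment> \<open>At \<open>y = q\<close> both sides are zero, so the polar form holds on all of
    \<open>U\<close>.\<close>
  proof (cases "y = q")
    case False
    have unit: "(y - q) /\<^sub>R norm (y - q) = vector [cos (\<phi> y), sin (\<phi> y)]"
      using assms(1) that by (simp add: angle_lift_def radial_projection_def)
    then show ?thesis
      using False by (simp flip: unit)
  qed simp
  have comp: "y$1 - q$1 = norm (y - q) * cos (\<phi> y)" "y$2 - q$2 = norm (y - q) * sin (\<phi> y)"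
    if "y \<in> U" for y
    using arg_cong[OF polar[OF that], of "\<lambda>z. z$1"] arg_cong[OF polar[OF that], of "\<lambda>z. z$2"]
    by simp_all
  have "C_k_on 1 U \<phi>"
    using assms(1) by (simp only: angle_lift_def smooth_on_def)
  then obtain \<phi>' where \<phi>': "(\<phi> has_derivative \<phi>') (at x)"
    using C_k_on_1_differentiable[OF _ assms(3)] unfolding differentiable_def by blast
  \<comment> \<open>The cross product of \<open>y - q\<close> with the unit direction of angle
    \<open>\<phi> y\<close>. It vanishes on \<open>U\<close>, so its derivative gives a linear
    equation for \<open>\<phi>'\<close>, whose coefficient is the radius by the polar form.\<close>
  let ?F = "\<lambda>y. (y$1 - q$1) * sin (\<phi> y) - (y$2 - q$2) * cos (\<phi> y)"
  have "(?F has_derivative (\<lambda>v. v$1 * sin (\<phi> x) - v$2 * cos (\<phi> x)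
      + ((x$1 - q$1) * cos (\<phi> x) + (x$2 - q$2) * sin (\<phi> x)) * \<phi>' v)) (at x)"
    by (auto intro!: derivative_eq_intros \<phi>' bounded_linear.has_derivative[OF bounded_linear_vec_nth]
      simp: algebra_simps)
  moreover have "(?F has_derivative (\<lambda>v. 0)) (at x)"
    by (rule has_derivative_transform_within_open[OF has_derivative_const[of 0] assms(2,3)])
      (simp add: comp)
  ultimately have "(\<lambda>v. v$1 * sin (\<phi> x) - v$2 * cos (\<phi> x)
      + ((x$1 - q$1) * cos (\<phi> x) + (x$2 - q$2) * sin (\<phi> x)) * \<phi>' v) = (\<lambda>v. 0)"
    by (rule has_derivative_unique)
  then have eq: "v$1 * sin (\<phi> x) - v$2 * cos (\<phi> x)
      + ((x$1 - q$1) * cos (\<phi> x) + (x$2 - q$2) * sin (\<phi> x)) * \<phi>' v = 0" for v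
    by (rule fun_cong)
  have "\<phi>' v = cross2 (x - q) v / (norm (x - q))\<^sup>2" for v
  proof -
    let ?n = "norm (x - q)"
    have "?n \<noteq> 0" using assms(4) by simp
    have "v$1 * sin (\<phi> x) - v$2 * cos (\<phi> x)
        + (?n * cos (\<phi> x) * cos (\<phi> x) + ?n * sin (\<phi> x) * sin (\<phi> x)) * \<phi>' v = 0"
      using eq[of v] by (simp only: comp[OF assms(3)])
    then have "?n * \<phi>' v = v$2 * cos (\<phi> x) - v$1 * sin (\<phi> x)"
      using sin_cos_squared_add3[of "\<phi> x"] by algebra
    \<comment> \<open>Multiplying by the radius once more turns its products with
      \<open>cos (\<phi> x)\<close> and \<open>sin (\<phi> x)\<close> into the coordinates of
      \<open>x - q\<close>.\<close>
    then have "?n\<^sup>2 * \<phi>' v = cross2 (x - q) v"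
      by (simp only: cross2_def vector_minus_component comp[OF assms(3)]) algebra
    then show ?thesis
      using \<open>?n \<noteq> 0\<close> by (simp add: field_simps)
  qed
  then show ?thesis
    using \<phi>' by presburger
qed

lemma has_derivative_vector_2:
  fixes f g :: "'a::real_normed_vector \<Rightarrow> real"
  assumes "(f has_derivative f') (at x)" "(g has_derivative g') (at x)"
  shows "((\<lambda>x. vector [f x, g x] :: real^2) has_derivative (\<lambda>v. vector [f' v, g' v])) (at x)"
proof -
  have *: "vector [a, b] = a *\<^sub>R axis 1 1 + b *\<^sub>R (axis 2 1 :: real^2)" for a b :: real
    by (simp add: vec_eq_iff forall_2 axis_def)
  show ?thesis
    unfolding * by (intro derivative_intros assms)
qed

lemma frechet_derivative_angle_pair:
  assumes "angle_lift q1 U \<phi>1" "angle_lift q2 U \<phi>2" "open U" "x \<in> U" "x \<noteq> q1" "x \<noteq> q2"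
  shows "frechet_derivative (\<lambda>x. vector [\<phi>1 x, \<phi>2 x] :: real^2) (at x) =
    (\<lambda>v. vector [cross2 (x - q1) v / (norm (x - q1))\<^sup>2, cross2 (x - q2) v / (norm (x - q2))\<^sup>2])"
  by (rule frechet_derivative_at[symmetric])
    (intro has_derivative_vector_2 has_derivative_angle_lift; use assms in simp)

text \<open>The rows of the matrix are \<open>x - q1\<close> and \<open>x - q2\<close>, rotated by a
  right angle and scaled, so the determinant is a scaled \<open>cross2 (x - q1) (x - q2)\<close>.
  Substituting \<open>x - q2 = (x - q1) - (q2 - q1)\<close> gives the stated numerator, the function
  of \<open>affine_hull_2_cross2\<close>.\<close>

lemma jacobian_det_angle_pair:
  assumes "angle_lift q1 U \<phi>1" "angle_lift q2 U \<phi>2" "open U" "x \<in> U" "x \<noteq> q1" "x \<noteq> q2"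
  shows "jacobian_det (\<lambda>x. vector [\<phi>1 x, \<phi>2 x] :: real^2) x =
    cross2 (q2 - q1) (x - q1) / ((norm (x - q1))\<^sup>2 * (norm (x - q2))\<^sup>2)"
  unfolding jacobian_det_def frechet_derivative_angle_pair[OF assms] det_2 matrix_def
  using assms(5,6) by (simp add: cross2_def axis_def field_simps)

section \<open>Critical set, tangential rank and fold condition\<close>

theorem proposition3p1:
  fixes q1 q2 :: "real^2" and U L :: "(real^2) set"
    and \<phi>1 \<phi>2 :: "real^2 \<Rightarrow> real" and H :: "real^2 \<Rightarrow> real^2"
  assumes "q1 \<noteq> q2"
    and L: "L = affine hull {q1, q2}"
    and "open U" and "U \<subseteq> - {q1, q2}"
    and "angle_lift q1 U \<phi>1" and "angle_lift q2 U \<phi>2"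
    and H: "H = (\<lambda>x. vector [\<phi>1 x, \<phi>2 x])"
  shows "critical_set U H = L \<inter> U
    \<and> critical_hypersurface U H (L \<inter> U)
    \<and> critical_hypersurface_condition U H
    \<and> (\<forall>x \<in> L \<inter> U. tangential_rank H L x = 0)
    \<and> (\<forall>M. critical_hypersurface U H M \<longrightarrow>
          (\<forall>x \<in> L \<inter> U. tangential_rank H M x \<noteq> 1))
    \<and> (L \<inter> U \<noteq> {} \<longrightarrow>
          (\<forall>M. critical_hypersurface U H M \<longrightarrow> \<not> tangential_immersion_condition H M))
    \<and> (\<forall>x \<in> L \<inter> U. \<not> fold_nondegenerate_at H x)"
proof -
  define d where "d = q2 - q1"
  have "d \<noteq> 0" using \<open>q1 \<noteq> q2\<close> by (simp add: d_def)
  have L_iff: "x \<in> L \<longleftrightarrow> cross2 d (x - q1) = 0" for x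
    unfolding L d_def by (rule affine_hull_2_cross2[OF \<open>q1 \<noteq> q2\<close>])
  have L_param: "L = {q1 + c *\<^sub>R d | c. True}"
    unfolding L d_def affine_hull_2_alt by auto
  have ne: "x \<noteq> q1" "x \<noteq> q2" if "x \<in> U" for x
    using that \<open>U \<subseteq> - {q1, q2}\<close> by auto
  note pair = \<open>angle_lift q1 U \<phi>1\<close> \<open>angle_lift q2 U \<phi>2\<close> \<open>open U\<close>
  have DH: "frechet_derivative H (at x) v =
      vector [cross2 (x - q1) v / (norm (x - q1))\<^sup>2, cross2 (x - q2) v / (norm (x - q2))\<^sup>2]"
    if "x \<in> U" for x v
    unfolding H using frechet_derivative_angle_pair[OF pair that ne[OF that]] by (rule fun_cong)
  have J: "jacobian_det H x = cross2 d (x - q1) / ((norm (x - q1))\<^sup>2 * (norm (x - q2))\<^sup>2)"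
    if "x \<in> U" for x
    unfolding H d_def by (rule jacobian_det_angle_pair[OF pair that ne[OF that]])
  have "jacobian_det H x = 0 \<longleftrightarrow> rank (matrix (frechet_derivative H (at x))) \<le> 1" for x
    by (auto simp: jacobian_det_def det_eq_0_rank)
  moreover have "jacobian_det H x = 0 \<longleftrightarrow> x \<in> L" if "x \<in> U" for x
    using J[OF that] ne[OF that] by (simp add: L_iff)
  ultimately have crit: "critical_set U H = L \<inter> U"
    by (auto simp: critical_set_def)
  have hyper: "critical_hypersurface U H (L \<inter> U)"
    using C1_submanifold_affine_line[OF \<open>open U\<close> \<open>d \<noteq> 0\<close>, of q1]
    by (simp add: critical_hypersurface_def crit L_param)
  \<comment> \<open>On the line both \<open>x - q1\<close> and \<open>x - q2\<close> are multiples
    of \<open>d\<close>, so both cross products with \<open>d\<close> vanish.\<close>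
  have kernel: "frechet_derivative H (at x) (c *\<^sub>R d) = 0" if x: "x \<in> L \<inter> U" for x c
  proof -
    obtain a where "x = q1 + a *\<^sub>R d" using x by (auto simp: L_param)
    then have "x - q1 = a *\<^sub>R d" "x - q2 = (a - 1) *\<^sub>R d"
      by (simp_all add: d_def algebra_simps)
    then have "cross2 (x - q1) (c *\<^sub>R d) = 0" "cross2 (x - q2) (c *\<^sub>R d) = 0"
      by (simp_all add: cross2.scaleR_left cross2.scaleR_right)
    then show ?thesis
      using x by (simp add: DH vec_eq_iff forall_2)
  qed
  \<comment> \<open>Stated for an arbitrary set \<open>M\<close>, to serve both the whole line
    \<open>L\<close> and every hypersurface containing the critical set.\<close>
  have rank_0: "tangential_rank H M x = 0"
    if x: "x \<in> L \<inter> U" and T: "\<And>v. v \<in> tangent_space M x \<Longrightarrow> \<exists>c. v = c *\<^sub>R d" for M x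
  proof -
    have "frechet_derivative H (at x) ` tangent_space M x \<subseteq> {0}"
      using kernel[OF x] T by fastforce
    then show ?thesis
      by (simp add: tangential_rank_def)
  qed
  have rank_L: "tangential_rank H L x = 0" if "x \<in> L \<inter> U" for x
    using that
  proof (rule rank_0)
    fix v assume "v \<in> tangent_space L x"
    then have "cross2 d v = 0"
      unfolding L d_def by (rule tangent_space_affine_hull_2[OF \<open>q1 \<noteq> q2\<close>])
    then show "\<exists>c. v = c *\<^sub>R d"
      using \<open>d \<noteq> 0\<close> by (simp add: cross2_eq_0_iff)
  qed
  have line: "x + c *\<^sub>R d \<in> L" if "x \<in> L" for x c
    using that by (auto simp: L_iff cross2.add_right cross2.diff_right cross2.scaleR_right)
  have rank_M: "tangential_rank H M x = 0"
    if M: "critical_hypersurface U H M" and x: "x \<in> L \<inter> U" for M x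
    using x
  proof (rule rank_0)
    have sub: "C1_submanifold 1 M" "L \<inter> U \<subseteq> M"
      using M by (simp_all add: critical_hypersurface_def crit)
    \<comment> \<open>As \<open>M\<close> contains \<open>L \<inter> U\<close>, short segments along
      \<open>d\<close> lie in \<open>M\<close>; the tangent space of \<open>M\<close> is then
      confined to multiples of \<open>d\<close>.\<close>
    then have "d \<in> tangent_space M x"
      using \<open>open U\<close> x line by (intro line_direction_in_tangent_space[of U]) auto
    then show "\<exists>c. v = c *\<^sub>R d" if "v \<in> tangent_space M x" for v
      using tangent_space_subset_line[OF sub(1) _ _ \<open>d \<noteq> 0\<close> that] sub(2) x by blast
  qed
  have not_fold: "\<not> fold_nondegenerate_at H x" if x: "x \<in> L \<inter> U" for x
  proof -
    let ?N = "\<lambda>y. (norm (y - q1))\<^sup>2 * (norm (y - q2))\<^sup>2"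
    have xU: "x \<in> U" and xL: "cross2 d (x - q1) = 0" using x by (auto simp: L_iff)
    have "((\<lambda>y. cross2 d (y - q1)) has_derivative (\<lambda>v. cross2 d (v - 0))) (at x)"
      by (intro bounded_linear.has_derivative[OF cross2.bounded_linear_right] derivative_intros)
    \<comment> \<open>Differentiability of the reciprocal is enough: in the product rule its
      derivative \<open>G\<close> is multiplied by \<open>cross2 d (x - q1)\<close>, which is zero
      on the line.\<close>
    moreover have "(\<lambda>y. inverse (?N y)) differentiable (at x)"
      using ne[OF xU] unfolding power2_norm_eq_inner
      by (intro derivative_intros differentiable_inner) auto
    then obtain G where "((\<lambda>y. inverse (?N y)) has_derivative G) (at x)"
      by (auto simp: differentiable_def)
    ultimately have "((\<lambda>y. cross2 d (y - q1) * inverse (?N y)) has_derivative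
        (\<lambda>v. cross2 d (x - q1) * G v + cross2 d (v - 0) * inverse (?N x))) (at x)"
      by (rule has_derivative_mult)
    then have "(jacobian_det H has_derivative
        (\<lambda>v. cross2 d (x - q1) * G v + cross2 d (v - 0) * inverse (?N x))) (at x)"
      by (rule has_derivative_transform_within_open[OF _ \<open>open U\<close> xU]) (simp add: J divide_inverse)
    \<comment> \<open>The first summand vanishes since \<open>x\<close> is on the line, the second
      since \<open>cross2 d d = 0\<close>.\<close>
    then have "frechet_derivative (jacobian_det H) (at x) d = 0"
      using xL by (simp add: frechet_derivative_at[symmetric])
    then show ?thesis
      using kernel[OF x, of 1] \<open>d \<noteq> 0\<close> by (auto simp: fold_nondegenerate_at_def)
  qed
  \<comment> \<open>A point of \<open>L \<inter> U\<close> is the counterexample; if there were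
    none, \<open>M = {}\<close> would satisfy the condition vacuously.\<close>
  have "\<not> tangential_immersion_condition H M"
    if nonempty: "L \<inter> U \<noteq> {}" and M: "critical_hypersurface U H M" for M
  proof -
    obtain x where x: "x \<in> L \<inter> U" using nonempty by blast
    then have "x \<in> M" using M by (auto simp: critical_hypersurface_def crit)
    with rank_M[OF M x] show ?thesis
      by (force simp: tangential_immersion_condition_def)
  qed
  with crit hyper rank_L rank_M not_fold show ?thesis
    by (auto simp: critical_hypersurface_condition_def)
qed

end
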